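(* Let $\Omega$ be a non-empty finite set, let $f\colon\Omega\to\mathbb{R}$ be a gamble, and let $\mathcal{D}=\{g_1,\dots,g_n\}$ be a finite set of gambles on $\Omega$ that avoids sure loss. Then $\mathcal{D}\cup\{f\}$ avoids sure loss if and only if $\overline{E}_{\mathcal{D}}(f)\ge0$. Moreover, if $\mathcal{D}\cup\{f\}$ does not avoid sure loss, then there exist $\lambda_1\ge0,\dots,\lambda_n\ge0$ such that $f+\sum_{i=1}^{n}\lambda_ig_i$ results in a loss of at least $|\overline{E}_{\mathcal{D}}(f)|$, that is, $$f(\omega)+\sum_{i=1}^{n}\lambda_ig_i(\omega)\le-|\overline{E}_{\mathcal{D}}(f)|\quad\text{for all }\omega\in\Omega.$$
   Context: A gamble is a real-valued function on the finite set $\Omega$; inequalities between gambles are pointwise and constants are identified with constant gambles. A set $\mathcal{D}$ of gambles avoids sure loss if for all $N\in\mathbb{N}$, all $\lambda_1,\dots,\lambda_N\ge0$ and all $f_1,\dots,f_N\in\mathcal{D}$ one has $\max_{\omega\in\Omega}\sum_{i=1}^{N}\lambda_if_i(\omega)\ge0$. The upper natural extension associated with $\mathcal{D}$ is defined for every gamble $f$ by $$\overline{E}_{\mathcal{D}}(f):=\inf\Big\{\beta\in\mathbb{R}\colon \beta-f\ge\sum_{i=1}^{N}\lambda_if_i,\ N\in\mathbb{N},\ f_i\in\mathcal{D},\ \lambda_i\ge0\Big\}.$$ *)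

theory Defs
  imports "HOL-Analysis.Analysis"
begin

type_synonym 'w gamble = "'w \<Rightarrow> real"

text \<open>The possibility space is a type of class \<open>finite\<close>. The number \<open>N\<close> of summands may be
  zero; the empty sum is the zero gamble. For a non-empty set of gambles this changes nothing (take
  a zero coefficient), and it makes both definitions sensible for the empty set as well.\<close>

definition avoids_sure_loss :: "('w::finite) gamble set \<Rightarrow> bool" where
  "avoids_sure_loss D \<longleftrightarrow>
    (\<forall>(N::nat) (l :: nat \<Rightarrow> real) (h :: nat \<Rightarrow> 'w gamble).
      (\<forall>i\<in>{1..N}. 0 \<le> l i \<and> h i \<in> D) \<longrightarrow>
      0 \<le> Max (range (\<lambda>w. \<Sum>i=1..N. l i * h i w)))"

text \<open>The infimum is taken in the extended reals: if \<open>D\<close> does not avoid sure loss, it is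
  \<open>-\<infinity>\<close>, whereas the infimum in type \<open>real\<close> would be unspecified.\<close>

definition upper_natural_extension :: "('w::finite) gamble set \<Rightarrow> 'w gamble \<Rightarrow> ereal" where
  "upper_natural_extension D f =
    Inf {ereal \<beta> | \<beta> :: real.
      \<exists>(N::nat) (l :: nat \<Rightarrow> real) (h :: nat \<Rightarrow> 'w gamble).
        (\<forall>i\<in>{1..N}. 0 \<le> l i \<and> h i \<in> D) \<and>
        (\<forall>w. \<beta> - f w \<ge> (\<Sum>i=1..N. l i * h i w))}"

end

theory Submission
  imports Defs
begin

text \<open>Finitely generated convex cones are closed, so the infimum defining the upper natural
  extension \<open>b\<close> is attained: some \<open>f + (\<Sum>i. l i * g i)\<close> lies below the constant \<open>b\<close>. If
  \<open>b < 0\<close>, this combination is a sure loss of at least \<open>\<bar>b\<bar>\<close>. Conversely, a sure loss for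
  \<open>D \<union> {f}\<close> must put a positive coefficient on \<open>f\<close>, because \<open>D\<close> avoids sure loss; dividing by it
  gives a negative number in the set over which the infimum is taken.\<close>

text \<open>Summands that use the same generator can be merged by adding their coefficients, and
  conversely a finite index set can be enumerated. So sequences of arbitrary length give way to one
  coefficient per index, even if \<open>g\<close> is not injective. The predicate \<open>P\<close>
  is arbitrary so that the lemma serves both sure loss and the natural extension.\<close>

lemma conic_combinations_image_iff:
  fixes g :: "'i \<Rightarrow> 'a \<Rightarrow> real"
  assumes "finite I"
  shows "(\<exists>(N::nat) (l::nat \<Rightarrow> real) h. (\<forall>i\<in>{1..N}. 0 \<le> l i \<and> h i \<in> g ` I) \<and>
             P (\<lambda>w. \<Sum>i=1..N. l i * h i w)) \<longleftrightarrow>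
         (\<exists>l. (\<forall>i\<in>I. 0 \<le> l i) \<and> P (\<lambda>w. \<Sum>i\<in>I. l i * g i w))" (is "?L \<longleftrightarrow> ?R")
proof
  assume ?L
  then obtain N :: nat and l :: "nat \<Rightarrow> real" and h
    where lh: "\<forall>i\<in>{1..N}. 0 \<le> l i \<and> h i \<in> g ` I" and P: "P (\<lambda>w. \<Sum>i=1..N. l i * h i w)"
    by blast
  from lh have "\<forall>i\<in>{1..N}. \<exists>j. j \<in> I \<and> h i = g j"
    by blast
  then obtain k where k: "\<forall>i\<in>{1..N}. k i \<in> I \<and> h i = g (k i)"
    by (rule bchoice[THEN exE])
  \<comment> \<open>\<open>k\<close> chooses one index for each summand; \<open>m j\<close> collects
    the coefficients of all summands assigned to \<open>j\<close>.\<close>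
  define m where "m j = (\<Sum>i | i \<in> {1..N} \<and> k i = j. l i)" for j
  have "(\<Sum>i=1..N. l i * h i w) = (\<Sum>j\<in>I. m j * g j w)" for w
  proof -
    have "(\<Sum>i=1..N. l i * h i w) = (\<Sum>j\<in>I. \<Sum>i | i \<in> {1..N} \<and> k i = j. l i * h i w)"
      using k assms by (intro sum.group[symmetric]) auto
    also have "\<dots> = (\<Sum>j\<in>I. m j * g j w)"
      unfolding m_def sum_distrib_right using k by (intro sum.cong refl) auto
    finally show ?thesis .
  qed
  moreover have "0 \<le> m j" for j
    unfolding m_def using lh by (intro sum_nonneg) auto
  ultimately show ?R
    using P by (intro exI[of _ m]) simp
next
  assume ?R
  then obtain l where l: "\<forall>i\<in>I. 0 \<le> l i" and P: "P (\<lambda>w. \<Sum>i\<in>I. l i * g i w)"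
    by blast
  obtain e where e: "bij_betw e {1..card I} I"
    using ex_bij_betw_nat_finite_1[OF assms] by blast
  have "(\<Sum>i=1..card I. l (e i) * g (e i) w) = (\<Sum>i\<in>I. l i * g i w)" for w
    by (rule sum.reindex_bij_betw[OF e])
  moreover have "e i \<in> I" if "i \<in> {1..card I}" for i
    using e that by (rule bij_betw_apply)
  ultimately show ?L
    using P l by (intro exI[of _ "card I"] exI[of _ "\<lambda>i. l (e i)"] exI[of _ "\<lambda>i. g (e i)"]) simp
qed

lemma avoids_sure_loss_image_iff:
  fixes g :: "'i \<Rightarrow> ('w::finite) gamble"
  assumes "finite I"
  shows "avoids_sure_loss (g ` I) \<longleftrightarrow>
    \<not> (\<exists>l. (\<forall>i\<in>I. 0 \<le> l i) \<and> (\<forall>w. (\<Sum>i\<in>I. l i * g i w) < 0))"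
proof -
  have Max_iff: "0 \<le> Max (range x) \<longleftrightarrow> \<not> (\<forall>w. x w < 0)" for x :: "'w gamble"
    by (subst Max_ge_iff) (auto simp: not_less)
  have "avoids_sure_loss (g ` I) \<longleftrightarrow>
      \<not> (\<exists>(N::nat) l h. (\<forall>i\<in>{1..N}. 0 \<le> l i \<and> h i \<in> g ` I) \<and>
          (\<forall>w. (\<Sum>i=1..N. l i * h i w) < 0))"
    unfolding avoids_sure_loss_def Max_iff by (simp only: not_ex de_Morgan_conj imp_conv_disj)
  also have "\<dots> \<longleftrightarrow> \<not> (\<exists>l. (\<forall>i\<in>I. 0 \<le> l i) \<and> (\<forall>w. (\<Sum>i\<in>I. l i * g i w) < 0))"
    by (simp only: conic_combinations_image_iff[OF assms, of g "\<lambda>x. \<forall>w. x w < 0"])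
  finally show ?thesis .
qed

definition extension_bounds :: "'i set \<Rightarrow> ('i \<Rightarrow> 'w gamble) \<Rightarrow> 'w gamble \<Rightarrow> real set" where
  "extension_bounds I g f =
    {\<beta>. \<exists>l. (\<forall>i\<in>I. 0 \<le> l i) \<and> (\<forall>w. (\<Sum>i\<in>I. l i * g i w) \<le> \<beta> - f w)}"

text \<open>Isolates a set of real numbers under the extended real infimum, so that closedness and
  boundedness can be argued in type \<open>real\<close>.\<close>

lemma upper_natural_extension_image:
  fixes g :: "'i \<Rightarrow> ('w::finite) gamble"
  assumes "finite I"
  shows "upper_natural_extension (g ` I) f = Inf (ereal ` extension_bounds I g f)"
  unfolding upper_natural_extension_def extension_bounds_def
    conic_combinations_image_iff[OF assms, of g "\<lambda>x. \<forall>w. x w \<le> \<beta> - f w" for \<beta>]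
  by (simp add: image_Collect)

lemma convex_cone_sum:
  assumes "convex_cone C" "finite I" "\<And>i. i \<in> I \<Longrightarrow> x i \<in> C"
  shows "sum x I \<in> C"
  using assms(2,3)
  by (induction I) (auto intro: convex_cone_add convex_cone_contains_0 assms(1))

text \<open>Nonnegative slack in a pointwise inequality is itself a nonnegative combination of unit
  vectors. Adding these as generators therefore turns the inequality into membership in a finitely
  generated cone.\<close>

lemma convex_cone_hull_Un_axes:
  fixes v :: "'i \<Rightarrow> real^'w"
  assumes "finite I"
  shows "convex_cone hull (v ` I \<union> range (\<lambda>w. axis w 1)) =
    {x. \<exists>l. (\<forall>i\<in>I. 0 \<le> l i) \<and> (\<forall>w. (\<Sum>i\<in>I. l i * v i $ w) \<le> x $ w)}"
    (is "convex_cone hull ?T = ?K")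
proof
  show "convex_cone hull ?T \<subseteq> ?K"
  proof (rule hull_minimal)
    show "?T \<subseteq> ?K"
    proof safe
      fix i assume "i \<in> I"
      then show "\<exists>l. (\<forall>j\<in>I. 0 \<le> l j) \<and> (\<forall>w. (\<Sum>j\<in>I. l j * v j $ w) \<le> v i $ w)"
        using assms by (intro exI[of _ "\<lambda>j. if j = i then 1 else 0"]) 
          (simp add: if_distrib[of "\<lambda>c. c * _"] cong: if_cong)
    next
      fix w' :: 'w
      show "\<exists>l. (\<forall>j\<in>I. 0 \<le> l j) \<and> (\<forall>w. (\<Sum>j\<in>I. l j * v j $ w) \<le> axis w' 1 $ w)"
        by (intro exI[of _ "\<lambda>_. 0"]) (simp add: axis_def)
    qed
    show "convex_cone ?K"
      unfolding convex_cone_iff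
    proof (intro conjI ballI allI impI)
      show "0 \<in> ?K"
        by (auto intro!: exI[of _ "\<lambda>_. 0"])
    next
      fix x y assume "x \<in> ?K" "y \<in> ?K"
      then obtain l m where "\<forall>i\<in>I. 0 \<le> l i" "\<forall>w. (\<Sum>i\<in>I. l i * v i $ w) \<le> x $ w"
        "\<forall>i\<in>I. 0 \<le> m i" "\<forall>w. (\<Sum>i\<in>I. m i * v i $ w) \<le> y $ w" by blast
      then show "x + y \<in> ?K"
        by (auto intro!: exI[of _ "\<lambda>i. l i + m i"] add_mono simp: distrib_right sum.distrib)
    next
      fix x and c :: real assume "x \<in> ?K" "0 \<le> c"
      then obtain l where "\<forall>i\<in>I. 0 \<le> l i" "\<forall>w. (\<Sum>i\<in>I. l i * v i $ w) \<le> x $ w" by blast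
      with \<open>0 \<le> c\<close> show "c *\<^sub>R x \<in> ?K"
        by (auto intro!: exI[of _ "\<lambda>i. c * l i"] mult_left_mono
            simp: mult.assoc simp flip: sum_distrib_left)
    qed
  qed
next
  let ?C = "convex_cone hull ?T"
  show "?K \<subseteq> ?C"
  proof
    fix x assume "x \<in> ?K"
    then obtain l where l: "\<forall>i\<in>I. 0 \<le> l i" "\<forall>w. (\<Sum>i\<in>I. l i * v i $ w) \<le> x $ w" by blast
    \<comment> \<open>The slack at \<open>w\<close> is the coefficient of the unit vector
      \<open>axis w 1\<close>.\<close>
    define s where "s w = x $ w - (\<Sum>i\<in>I. l i * v i $ w)" for w
    have "x = (\<Sum>i\<in>I. l i *\<^sub>R v i) + (\<Sum>w\<in>UNIV. s w *\<^sub>R axis w 1)"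
      by (simp add: vec_eq_iff s_def axis_def if_distrib[of "\<lambda>c. _ * c"] cong: if_cong)
    also have "\<dots> \<in> ?C"
      using l assms
      by (intro convex_cone_hull_add convex_cone_sum convex_cone_hull_mul
          convex_cone_convex_cone_hull hull_inc) (auto simp: s_def)
    finally show "x \<in> ?C" .
  qed
qed

text \<open>The set is the preimage of a finitely generated, hence closed, convex cone under a
  continuous map from the reals.\<close>

lemma closed_extension_bounds:
  fixes g :: "'i \<Rightarrow> ('w::finite) gamble"
  assumes "finite I"
  shows "closed (extension_bounds I g f)"
proof -
  let ?K = "convex_cone hull ((\<lambda>i. \<chi> w. g i w) ` I \<union> range (\<lambda>w. axis w 1)) :: (real^'w) set"
  have "extension_bounds I g f = (\<lambda>\<beta>. \<chi> w. \<beta> - f w) -` ?K"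
    unfolding convex_cone_hull_Un_axes[OF assms] extension_bounds_def by auto
  moreover have "closed ?K"
    using assms by (intro closed_convex_cone_hull) simp
  ultimately show ?thesis
    by (auto intro!: closed_vimage continuous_intros)
qed

text \<open>Without sure loss, every combination is nonnegative at some point \<open>w\<close>, and
  there \<open>f w\<close> is at most \<beta>. This keeps the infimum from being minus
  infinity.\<close>

lemma extension_bounds_ge:
  fixes g :: "'i \<Rightarrow> ('w::finite) gamble"
  assumes "finite I" "avoids_sure_loss (g ` I)" "\<beta> \<in> extension_bounds I g f"
  shows "Min (range f) \<le> \<beta>"
proof -
  obtain l where l: "\<forall>i\<in>I. 0 \<le> l i" "\<forall>w. (\<Sum>i\<in>I. l i * g i w) \<le> \<beta> - f w"
    using assms(3) unfolding extension_bounds_def by blast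
  then obtain w where "0 \<le> (\<Sum>i\<in>I. l i * g i w)"
    using assms(2) unfolding avoids_sure_loss_image_iff[OF assms(1)] by (meson not_less)
  then have "f w \<le> \<beta>"
    using l(2)[rule_format, of w] by linarith
  then show ?thesis
    by (intro order_trans[OF Min_le]) auto
qed

lemma extension_bounds_nonempty:
  fixes f :: "('w::finite) gamble"
  shows "extension_bounds I g f \<noteq> {}"
proof -
  have "Max (range f) \<in> extension_bounds I g f"
    by (auto simp: extension_bounds_def intro!: exI[of _ "\<lambda>_. 0"])
  then show ?thesis by blast
qed

text \<open>A non-empty closed set of reals that is bounded below contains its infimum, which is
  then also the infimum in \<open>ereal\<close>.\<close>

lemma upper_natural_extension_attained:
  fixes g :: "'i \<Rightarrow> ('w::finite) gamble"
  assumes "finite I" "avoids_sure_loss (g ` I)"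
  obtains b where "upper_natural_extension (g ` I) f = ereal b" "b \<in> extension_bounds I g f"
    "\<And>\<beta>. \<beta> \<in> extension_bounds I g f \<Longrightarrow> b \<le> \<beta>"
proof
  let ?S = "extension_bounds I g f"
  have bdd: "bdd_below ?S"
    using extension_bounds_ge[OF assms] by (rule bdd_belowI)
  show mem: "Inf ?S \<in> ?S"
    by (intro closed_contains_Inf extension_bounds_nonempty bdd closed_extension_bounds assms)
  show le: "Inf ?S \<le> \<beta>" if "\<beta> \<in> ?S" for \<beta>
    using that bdd by (rule cInf_lower)
  show "upper_natural_extension (g ` I) f = ereal (Inf ?S)"
    unfolding upper_natural_extension_image[OF assms(1)]
    using mem le by (intro Inf_eqI) auto
qed

lemma avoids_sure_loss_insert_iff:
  fixes g :: "'i \<Rightarrow> ('w::finite) gamble"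
  assumes "finite I" "avoids_sure_loss (g ` I)"
  shows "avoids_sure_loss (insert f (g ` I)) \<longleftrightarrow> (\<forall>\<beta>\<in>extension_bounds I g f. 0 \<le> \<beta>)"
proof -
  \<comment> \<open>The index \<open>None\<close> is reserved for \<open>f\<close>, which thus has a
    coefficient of its own even if \<open>f\<close> already occurs among the
    \<open>g i\<close>.\<close>
  define g' where "g' = case_option f g"
  have image: "g' ` insert None (Some ` I) = insert f (g ` I)"
    by (simp add: g'_def image_image)
  have sum: "(\<Sum>i\<in>insert None (Some ` I). l i * g' i w) =
      l None * f w + (\<Sum>i\<in>I. l (Some i) * g i w)" for l :: "'i option \<Rightarrow> real" and w
    using assms(1) by (simp add: g'_def sum.reindex)
  have *: "avoids_sure_loss (insert f (g ` I)) \<longleftrightarrow>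
      \<not> (\<exists>l. 0 \<le> l None \<and> (\<forall>i\<in>I. 0 \<le> l (Some i)) \<and>
          (\<forall>w. l None * f w + (\<Sum>i\<in>I. l (Some i) * g i w) < 0))"
    using avoids_sure_loss_image_iff[of "insert None (Some ` I)" g'] assms(1)
    unfolding image sum by simp
  show ?thesis
  proof
    assume A: "avoids_sure_loss (insert f (g ` I))"
    show "\<forall>\<beta>\<in>extension_bounds I g f. 0 \<le> \<beta>"
    proof (intro ballI leI notI)
      fix \<beta> assume "\<beta> \<in> extension_bounds I g f" "\<beta> < 0"
      then obtain l where "\<forall>i\<in>I. 0 \<le> l i" "\<forall>w. (\<Sum>i\<in>I. l i * g i w) \<le> \<beta> - f w"
        unfolding extension_bounds_def by blast
      moreover from this(2) \<open>\<beta> < 0\<close> have "\<forall>w. f w + (\<Sum>i\<in>I. l i * g i w) < 0"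
        by (smt (verit))
      ultimately show False
        \<comment> \<open>The sure loss gives \<open>f\<close> the coefficient 1.\<close>
        using A unfolding * by (auto dest!: spec[of _ "case_option 1 l"])
    qed
  next
    assume nonneg: "\<forall>\<beta>\<in>extension_bounds I g f. 0 \<le> \<beta>"
    show "avoids_sure_loss (insert f (g ` I))"
      unfolding *
    proof clarify
      fix l assume l: "0 \<le> l None" "\<forall>i\<in>I. 0 \<le> l (Some i)"
        and neg: "\<forall>w. l None * f w + (\<Sum>i\<in>I. l (Some i) * g i w) < 0"
      define c where "c = l None"
      have "c \<noteq> 0"
        using l(2) neg assms(2) unfolding avoids_sure_loss_image_iff[OF assms(1)] c_def
        by (auto dest!: spec[of _ "\<lambda>i. l (Some i)"])
      with l(1) have c: "0 < c"
        by (simp add: c_def)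
      \<comment> \<open>\<open>r\<close> is the sure loss rescaled so that \<open>f\<close> has
        coefficient 1. Its maximum over the finite space is still negative, and it is the bound that
        contradicts \<open>nonneg\<close>.\<close>
      define r where "r w = f w + (\<Sum>i\<in>I. l (Some i) / c * g i w)" for w
      have "r w = (c * f w + (\<Sum>i\<in>I. l (Some i) * g i w)) / c" for w
        using c by (simp add: r_def add_divide_distrib sum_divide_distrib)
      then have "r w < 0" for w
        using neg c by (simp add: c_def divide_neg_pos)
      then have "Max (range r) < 0"
        by (subst Max_less_iff) auto
      moreover have "r w \<le> Max (range r)" for w
        by (rule Max_ge) auto
      then have "Max (range r) \<in> extension_bounds I g f"
        using l(2) c unfolding extension_bounds_def r_def
        by (auto intro!: exI[of _ "\<lambda>i. l (Some i) / c"] simp: le_diff_eq add.commute)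
      ultimately show False
        using nonneg by (meson not_less)
    qed
  qed
qed

theorem theorem4:
  fixes f :: "('w::finite) gamble"
    and g :: "nat \<Rightarrow> 'w gamble"
    and n :: nat
    and D :: "'w gamble set"
  assumes "D = g ` {1..n}"
    and "avoids_sure_loss D"
  shows "(avoids_sure_loss (D \<union> {f}) \<longleftrightarrow> upper_natural_extension D f \<ge> 0) \<and>
    (\<not> avoids_sure_loss (D \<union> {f}) \<longrightarrow>
      (\<exists>l :: nat \<Rightarrow> real.
        (\<forall>i\<in>{1..n}. 0 \<le> l i) \<and>
        (\<forall>w. ereal (f w + (\<Sum>i=1..n. l i * g i w)) \<le> - \<bar>upper_natural_extension D f\<bar>)))"
proof -
  have D: "avoids_sure_loss (g ` {1..n})"
    using assms by simp
  obtain b where b: "upper_natural_extension D f = ereal b"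
    and mem: "b \<in> extension_bounds {1..n} g f"
    and le: "\<And>\<beta>. \<beta> \<in> extension_bounds {1..n} g f \<Longrightarrow> b \<le> \<beta>"
    using upper_natural_extension_attained[OF finite_atLeastAtMost D, of f] assms(1) by blast
  have iff: "avoids_sure_loss (D \<union> {f}) \<longleftrightarrow> 0 \<le> b"
    using avoids_sure_loss_insert_iff[OF finite_atLeastAtMost D, of f] mem le
    unfolding assms(1) by (auto intro: order_trans)
  obtain l where "\<forall>i\<in>{1..n}. 0 \<le> l i" "\<forall>w. (\<Sum>i=1..n. l i * g i w) \<le> b - f w"
    using mem unfolding extension_bounds_def by blast
  then show ?thesis
    \<comment> \<open>If sure loss is not avoided, then \<open>b < 0\<close>, so minus the absolute
      value of \<open>b\<close> is \<open>b\<close> itself; the coefficients \<open>l\<close> that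
      attain the infimum give exactly this bound.\<close>
    unfolding iff b by (auto intro!: exI[of _ l] simp: le_diff_eq add.commute)
qed

end
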